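(* Let $m\ge1$ and $u,v\in\mathcal{W}(B_{2m+1})$ with $u<v$ in Bruhat order and $v^{-1}(2m+1)<u^{-1}(2m+1)$ (as integers in $[\pm(2m+1)]$). Then $u\leqslant c(v)$.
   Context: For $k\ge1$, $B_k$ is the group of bijections $w$ of $[\pm k]=\{-k,\dots,-1,1,\dots,k\}$ with $w(-a)=-w(a)$; it is a Coxeter group with generators $(1,-1)$ and $(a,a+1)(-a,-a-1)$, $a\in[k-1]$; $\leqslant$ is Bruhat order. For $a\in[n]$ let $a^*=a-1$ if $a$ even, $a^*=a+1$ if $a$ odd and $a+1\le n$, $a^*=n$ otherwise; $\mathcal{W}(B_n)=\{v\in B_n: |v^{-1}(a)-v^{-1}(a^* )|\le1\ \forall a\in[n-1]\}$ (here $v^{-1}(a)\in[\pm n]$). For $v\in\mathcal{W}(B_{2m+1})$ let $j:=v^{-1}(2m+1)$ and define $c(v):=v\circ t\in\mathcal{W}(B_{2m+1})$ (composition of functions on $[\pm(2m+1)]$), where $t=(1,-1)$ if $j=-1$; $t=(j+1,j+2)(-j-1,-j-2)$ if $j\neq-1$ and $v(j+1)>v(j+2)$; and $t=(j,j+2)(-j,-j-2)$ if $j\neq-1$ and $v(j+1)<v(j+2)$. *)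

theory Defs
  imports Complex_Main "HOL-Combinatorics.Permutations"
begin

definition pm :: "nat \<Rightarrow> int set" where
  "pm k = {- int k..int k} - {0}"

text \<open>Signed permutations are extended to all integers by the identity outside \<^term>\<open>pm k\<close>
  (this is part of \<^term>\<open>w permutes A\<close>), so that the group operation is \<^term>\<open>(\<circ>)\<close> and
  group inverses are given by \<^term>\<open>inv\<close>.\<close>

definition B_group :: "nat \<Rightarrow> (int \<Rightarrow> int) set" where
  "B_group k = {w. w permutes pm k \<and> (\<forall>a\<in>pm k. w (- a) = - w a)}"

definition stransp :: "int \<Rightarrow> int \<Rightarrow> int \<Rightarrow> int" where
  "stransp a b = transpose a b \<circ> transpose (- a) (- b)"

definition B_gens :: "nat \<Rightarrow> (int \<Rightarrow> int) set" where
  "B_gens k = insert (transpose 1 (- 1)) {stransp a (a + 1) | a. a \<in> {1..int k - 1}}"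

definition B_length :: "nat \<Rightarrow> (int \<Rightarrow> int) \<Rightarrow> nat" where
  "B_length k w = (LEAST l. \<exists>ss. set ss \<subseteq> B_gens k \<and> length ss = l \<and> foldr (\<circ>) ss id = w)"

definition B_reflections :: "nat \<Rightarrow> (int \<Rightarrow> int) set" where
  "B_reflections k = {w \<circ> s \<circ> inv w | w s. w \<in> B_group k \<and> s \<in> B_gens k}"

definition bruhat_step :: "nat \<Rightarrow> (int \<Rightarrow> int) \<Rightarrow> (int \<Rightarrow> int) \<Rightarrow> bool" where
  "bruhat_step k u w \<longleftrightarrow> (\<exists>t\<in>B_reflections k. w = u \<circ> t \<and> B_length k u < B_length k w)"

definition bruhat_le :: "nat \<Rightarrow> (int \<Rightarrow> int) \<Rightarrow> (int \<Rightarrow> int) \<Rightarrow> bool" where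
  "bruhat_le k u w \<longleftrightarrow> u \<in> B_group k \<and> w \<in> B_group k \<and> (bruhat_step k)\<^sup>*\<^sup>* u w"

definition bruhat_less :: "nat \<Rightarrow> (int \<Rightarrow> int) \<Rightarrow> (int \<Rightarrow> int) \<Rightarrow> bool" where
  "bruhat_less k u w \<longleftrightarrow> bruhat_le k u w \<and> u \<noteq> w"

definition star :: "nat \<Rightarrow> int \<Rightarrow> int" where
  "star n a = (if even a then a - 1 else if a + 1 \<le> int n then a + 1 else int n)"

definition W_set :: "nat \<Rightarrow> (int \<Rightarrow> int) set" where
  "W_set n = {v \<in> B_group n. \<forall>a\<in>{1..int n - 1}. \<bar>inv v a - inv v (star n a)\<bar> \<le> 1}"

text \<open>Intended for odd \<^term>\<open>n\<close> and \<^term>\<open>v \<in> W_set n\<close>. Then \<^term>\<open>j\<close> is odd, so \<^term>\<open>j + 1\<close> and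
  \<^term>\<open>j + 2\<close> lie in \<^term>\<open>pm n\<close> unless \<^term>\<open>j = -1\<close> or \<^term>\<open>j = int n\<close>; in the last case
  the operation has no meaning and its value is irrelevant.\<close>

definition c_op :: "nat \<Rightarrow> (int \<Rightarrow> int) \<Rightarrow> int \<Rightarrow> int" where
  "c_op n v = (let j = inv v (int n) in
     v \<circ> (if j = - 1 then transpose 1 (- 1)
          else if v (j + 1) > v (j + 2) then stransp (j + 1) (j + 2)
          else stransp j (j + 2)))"

end

theory Submission
  imports Defs "HOL-Library.Z2"
begin

text \<open>Bruhat order on \<open>B\<^sub>n\<close> is domination of the rank functions
  \<open>w[i, x] = #{a \<le> i. w a \<ge> x}\<close>. Passing from \<open>v\<close> to \<open>c(v)\<close> lowers \<open>v[i, x]\<close> by one on a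
  rectangle and on its mirror image, so it suffices that \<open>u[i, x] < v[i, x]\<close> there. This is a
  parity argument: if neither the cut after position \<open>i\<close> nor the threshold \<open>x\<close> separates a pair
  \<open>{a, a\<^sup>*}\<close>, then all pairs contribute even numbers to both ranks, whereas the unpaired value
  \<open>n = 2m + 1\<close> is counted for \<open>v\<close> but not for \<open>u\<close>; hence the ranks differ. A threshold that
  separates a pair is the midpoint of two that do not, and both ranks are affine between these.
  The remaining cuts are compared with neighbouring ones.\<close>

section \<open>Signed permutations\<close>

lemma pm_iff: "a \<in> pm n \<longleftrightarrow> a \<noteq> 0 \<and> \<bar>a\<bar> \<le> int n"
  by (auto simp: pm_def)

lemma pm_nonzero: "a \<in> pm n \<Longrightarrow> a \<noteq> 0"
  by (simp add: pm_iff)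

lemma uminus_in_pm_iff: "- a \<in> pm n \<longleftrightarrow> a \<in> pm n"
  by (auto simp: pm_iff)

lemma finite_pm: "finite (pm n)"
  by (simp add: pm_def)

lemma B_group_permutes: "w \<in> B_group n \<Longrightarrow> w permutes pm n"
  by (simp add: B_group_def)

lemma B_group_eq_iff: "w \<in> B_group n \<Longrightarrow> w a = w b \<longleftrightarrow> a = b"
  using B_group_permutes permutes_inj by (metis inj_eq)

lemma B_group_in_pm_iff: "w \<in> B_group n \<Longrightarrow> w a \<in> pm n \<longleftrightarrow> a \<in> pm n"
  by (simp add: B_group_permutes permutes_in_image)

lemma B_group_outside: "w \<in> B_group n \<Longrightarrow> a \<notin> pm n \<Longrightarrow> w a = a"
  by (rule permutes_not_in[OF B_group_permutes])

lemma B_group_minus: "w \<in> B_group n \<Longrightarrow> w (- a) = - w a"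
  using B_group_outside[of w n a] B_group_outside[of w n "- a"]
  by (cases "a \<in> pm n") (simp_all add: B_group_def uminus_in_pm_iff)

lemma B_group_zero: "w \<in> B_group n \<Longrightarrow> w 0 = 0"
  using B_group_outside[of w n 0] by (simp add: pm_iff)

lemma B_groupI: "w permutes pm n \<Longrightarrow> (\<And>a. a \<in> pm n \<Longrightarrow> w (- a) = - w a) \<Longrightarrow> w \<in> B_group n"
  by (simp add: B_group_def)

lemma id_in_B_group: "id \<in> B_group n"
  by (rule B_groupI) (simp_all add: permutes_id)

lemma comp_in_B_group: "u \<in> B_group n \<Longrightarrow> w \<in> B_group n \<Longrightarrow> u \<circ> w \<in> B_group n"
  by (rule B_groupI) (simp_all add: B_group_permutes permutes_compose B_group_minus)

lemma B_group_inverses: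
  assumes "w \<in> B_group n"
  shows "w (inv w a) = a" "inv w (w a) = a"
  using permutes_inverses[OF B_group_permutes[OF assms]] by auto

lemma inv_in_B_group:
  assumes "w \<in> B_group n"
  shows "inv w \<in> B_group n"
proof (rule B_groupI)
  show "inv w permutes pm n"
    using B_group_permutes[OF assms] by (rule permutes_inv)
  have "w (- inv w a) = - a" for a
    by (simp add: B_group_minus[OF assms] B_group_inverses[OF assms])
  then show "inv w (- a) = - inv w a" for a
    using B_group_inverses(2)[OF assms] by metis
qed

text \<open>Unlike \<^const>\<open>stransp\<close>, which is the identity when \<^prop>\<open>b = - a\<close>, this
  exchanges \<^term>\<open>a\<close> and \<^term>\<open>b\<close> in that case too.\<close>

definition reflection :: "int \<Rightarrow> int \<Rightarrow> int \<Rightarrow> int" where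
  "reflection a b = (if a = - b then transpose a b else stransp a b)"

lemma reflection_apply:
  assumes "a \<noteq> 0" "b \<noteq> 0"
  shows "reflection a b c =
    (if c = a then b else if c = b then a
     else if c = - a then - b else if c = - b then - a else c)"
  using assms by (auto simp: reflection_def stransp_def transpose_def)

lemma reflection_commute: "reflection a b = reflection b a"
  by (auto simp: reflection_def stransp_def transpose_commute)

lemma reflection_minus: "a \<noteq> 0 \<Longrightarrow> b \<noteq> 0 \<Longrightarrow> reflection (- b) (- a) = reflection a b"
  by (rule ext) (auto simp: reflection_apply)

lemma reflection_involutory: "a \<noteq> 0 \<Longrightarrow> b \<noteq> 0 \<Longrightarrow> reflection a b \<circ> reflection a b = id"
  by (rule ext) (auto simp: reflection_apply)

lemma comp_reflection_reflection:
  "a \<noteq> 0 \<Longrightarrow> b \<noteq> 0 \<Longrightarrow> w \<circ> reflection a b \<circ> reflection a b = w"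
  by (metis comp_assoc comp_id reflection_involutory)

lemma reflection_in_B_group:
  assumes "a \<in> pm n" "b \<in> pm n"
  shows "reflection a b \<in> B_group n"
proof (rule B_groupI)
  note nonzero = pm_nonzero[OF assms(1)] pm_nonzero[OF assms(2)]
  have "bij_betw (reflection a b) (pm n) (pm n)"
    by (rule bij_betwI[where g = "reflection a b"])
      (use assms nonzero in \<open>auto simp: reflection_apply uminus_in_pm_iff\<close>)
  then show "reflection a b permutes pm n"
    by (rule bij_imp_permutes)
      (use assms nonzero in \<open>auto simp: reflection_apply uminus_in_pm_iff\<close>)
  show "reflection a b (- c) = - reflection a b c" for c
    using nonzero by (auto simp: reflection_apply)
qed

lemma comp_reflection_in_B_group:
  "w \<in> B_group n \<Longrightarrow> a \<in> pm n \<Longrightarrow> b \<in> pm n \<Longrightarrow> w \<circ> reflection a b \<in> B_group n"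
  by (intro comp_in_B_group reflection_in_B_group)

lemma comp_reflection:
  assumes "w \<in> B_group n" "a \<in> pm n" "b \<in> pm n"
  shows "w \<circ> reflection a b = reflection (w a) (w b) \<circ> w"
proof
  fix c
  note w_in_B = assms(1)
  have nonzero: "a \<noteq> 0" "b \<noteq> 0" "w a \<noteq> 0" "w b \<noteq> 0"
    using assms B_group_in_pm_iff[OF w_in_B, THEN iffD2, THEN pm_nonzero] pm_nonzero by auto
  have "w c = w d \<longleftrightarrow> c = d" "w c = - w d \<longleftrightarrow> c = - d" for d
    using B_group_eq_iff[OF w_in_B] by (simp_all flip: B_group_minus[OF w_in_B])
  then show "(w \<circ> reflection a b) c = (reflection (w a) (w b) \<circ> w) c"
    using B_group_minus[OF w_in_B] by (simp add: reflection_apply nonzero)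
qed

lemma comp_reflection_comp_inv:
  assumes "w \<in> B_group n" "a \<in> pm n" "b \<in> pm n"
  shows "w \<circ> reflection a b \<circ> inv w = reflection (w a) (w b)"
  unfolding comp_reflection[OF assms] using B_group_inverses[OF assms(1)]
  by (simp add: fun_eq_iff)

lemma B_group_transitive_on_pairs:
  assumes "a \<in> pm n" "b \<in> pm n" "a \<noteq> b" "a \<noteq> - b"
  shows "\<exists>w\<in>B_group n. w 1 = a \<and> w 2 = b"
proof -
  define g where "g = reflection 1 a"
  have "1 \<in> pm n" "2 \<in> pm n"
    using assms by (auto simp: pm_iff)
  then have g_in_B: "g \<in> B_group n"
    unfolding g_def using assms by (intro reflection_in_B_group)
  have g_1: "g 1 = a"
    using assms by (simp add: g_def reflection_apply pm_iff)
  have "g 2 \<in> pm n"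
    using B_group_in_pm_iff[OF g_in_B] \<open>2 \<in> pm n\<close> by simp
  moreover have "g 2 \<noteq> g 1" "g 2 \<noteq> g (- 1)"
    using B_group_eq_iff[OF g_in_B] by simp_all
  ultimately have g_2: "g 2 \<in> pm n" "g 2 \<noteq> a" "g 2 \<noteq> - a"
    using B_group_minus[OF g_in_B, of 1] g_1 by simp_all
  define w where "w = reflection (g 2) b \<circ> g"
  have "w \<in> B_group n"
    unfolding w_def using g_in_B g_2 assms by (intro comp_in_B_group reflection_in_B_group)
  moreover have "w 1 = a" "w 2 = b"
    unfolding w_def using g_1 g_2 assms by (auto simp: reflection_apply pm_nonzero)
  ultimately show ?thesis by blast
qed

section \<open>Simple reflections, descents and inversions\<close>

definition adjacent :: "nat \<Rightarrow> int \<Rightarrow> int \<Rightarrow> bool" where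
  "adjacent n p q \<longleftrightarrow> (p = - 1 \<and> q = 1) \<or> (1 \<le> p \<and> p < int n \<and> q = p + 1)"

lemma adjacent_in_pm:
  assumes "n \<ge> 1" "adjacent n p q"
  shows "p \<in> pm n" "q \<in> pm n" "p < q"
  using assms by (auto simp: adjacent_def pm_iff)

lemma adjacent_no_between: "adjacent n p q \<Longrightarrow> p < a \<Longrightarrow> a \<in> pm n \<Longrightarrow> q \<le> a"
  by (auto simp: adjacent_def pm_iff)

lemma B_gens_iff: "s \<in> B_gens n \<longleftrightarrow> (\<exists>p q. adjacent n p q \<and> s = reflection p q)"
proof -
  have "stransp a (a + 1) = reflection a (a + 1)" if "a \<ge> 1" for a
    using that by (auto simp: reflection_def)
  moreover have "transpose 1 (- 1) = reflection (- 1) 1"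
    by (simp add: reflection_def transpose_commute)
  ultimately show ?thesis
    by (auto simp: B_gens_def adjacent_def)
qed

lemma B_gens_subset_B_group: "n \<ge> 1 \<Longrightarrow> B_gens n \<subseteq> B_group n"
  using adjacent_in_pm reflection_in_B_group by (auto simp: B_gens_iff)

lemma B_group_maps_adjacent_pair:
  assumes "n \<ge> 1" "a \<in> pm n" "b \<in> pm n" "a \<noteq> b"
  obtains w p q where "w \<in> B_group n" "adjacent n p q" "w p = a" "w q = b"
proof (cases "a = - b")
  case True
  have "reflection 1 b \<in> B_group n"
    using assms by (intro reflection_in_B_group) (auto simp: pm_iff)
  moreover have "adjacent n (- 1) 1"
    by (simp add: adjacent_def)
  moreover have "reflection 1 b (- 1) = a" "reflection 1 b 1 = b"
    using True assms by (auto simp: reflection_apply pm_nonzero)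
  ultimately show ?thesis
    by (rule that)
next
  case False
  moreover have "adjacent n 1 2"
    using False assms by (auto simp: adjacent_def pm_iff)
  ultimately show ?thesis
    using B_group_transitive_on_pairs assms that by blast
qed

lemma B_reflections_iff:
  assumes "n \<ge> 1"
  shows "t \<in> B_reflections n \<longleftrightarrow> (\<exists>a\<in>pm n. \<exists>b\<in>pm n. a < b \<and> t = reflection a b)"
proof
  assume "t \<in> B_reflections n"
  then obtain w p q where w_in_B: "w \<in> B_group n" and adjacent_pq: "adjacent n p q"
    and "t = w \<circ> reflection p q \<circ> inv w"
    by (auto simp: B_reflections_def B_gens_iff)
  then have t_eq: "t = reflection (w p) (w q)"
    using comp_reflection_comp_inv adjacent_in_pm[OF assms adjacent_pq] by simp
  have "w p \<in> pm n" "w q \<in> pm n" "w p \<noteq> w q"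
    using adjacent_in_pm[OF assms adjacent_pq] B_group_in_pm_iff[OF w_in_B]
      B_group_eq_iff[OF w_in_B] by auto
  then show "\<exists>a\<in>pm n. \<exists>b\<in>pm n. a < b \<and> t = reflection a b"
    using t_eq reflection_commute by (metis linorder_neqE)
next
  assume "\<exists>a\<in>pm n. \<exists>b\<in>pm n. a < b \<and> t = reflection a b"
  then obtain a b where "a \<in> pm n" "b \<in> pm n" "a \<noteq> b" and t_eq: "t = reflection a b"
    by auto
  then obtain w p q where maps_pq: "w \<in> B_group n" "adjacent n p q" "w p = a" "w q = b"
    using B_group_maps_adjacent_pair[OF assms] by metis
  then have "t = w \<circ> reflection p q \<circ> inv w"
    using t_eq comp_reflection_comp_inv[of w n p q] adjacent_in_pm[OF assms] by simp
  moreover have "reflection p q \<in> B_gens n"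
    using maps_pq B_gens_iff by blast
  ultimately show "t \<in> B_reflections n"
    using maps_pq(1) unfolding B_reflections_def by blast
qed

lemma reflection_eq_if_adjacent_inverts:
  assumes "adjacent n p q" "a < b" "a \<noteq> 0" "b \<noteq> 0" "reflection p q b < reflection p q a"
  shows "reflection a b = reflection p q"
proof -
  have nonzero: "p \<noteq> 0" "q \<noteq> 0"
    using assms(1) by (auto simp: adjacent_def)
  have "(a = p \<and> b = q) \<or> (a = - q \<and> b = - p)"
    using assms(1) unfolding adjacent_def
  proof (elim disjE conjE)
    assume "p = - 1" "q = 1"
    then show ?thesis
      using assms(2-5) unfolding reflection_apply[OF nonzero] by (simp split: if_splits)
  next
    assume pq: "1 \<le> p" "q = p + 1"
    then have "\<bar>reflection p q c - c\<bar> \<le> 1" for c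
      by (simp add: reflection_apply)
    from this[of a] this[of b] have "b = a + 1" "reflection p q a = a + 1"
      using assms(2,5) by linarith+
    then show ?thesis
      using pq unfolding reflection_apply[OF nonzero]
      by (cases "a = p"; cases "a = q"; cases "a = - p"; cases "a = - q") simp_all
  qed
  then show ?thesis
    using reflection_minus nonzero by auto
qed

lemma B_group_mono_adjacent_imp_id:
  assumes w_in_B: "w \<in> B_group n" and mono: "\<And>p q. adjacent n p q \<Longrightarrow> w p < w q"
  shows "w = id"
proof -
  have increasing: "w a < w (a + 1)" if "1 \<le> a" "a < int n" for a
    using mono that by (simp add: adjacent_def)
  have lower: "a \<le> w a" if "1 \<le> a" "a \<le> int n" for a
    using that
  proof (induction a rule: int_ge_induct)
    case base
    show ?case
      using mono[of "- 1" 1] B_group_minus[OF w_in_B, of 1] by (simp add: adjacent_def)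
  next
    case (step a)
    then show ?case using increasing[of a] by simp
  qed
  have upper: "w a \<le> a" if "a \<le> int n" "1 \<le> a" for a
    using that
  proof (induction a rule: int_le_induct)
    case base
    then show ?case
      using B_group_in_pm_iff[OF w_in_B, of "int n"] by (auto simp: pm_iff)
  next
    case (step a)
    then show ?case using increasing[of "a - 1"] by simp
  qed
  have "w a = a" if "a \<in> pm n" for a
    using that lower[of "\<bar>a\<bar>"] upper[of "\<bar>a\<bar>"] B_group_minus[OF w_in_B, of a]
    by (cases "0 < a") (auto simp: pm_iff)
  then show ?thesis
    using B_group_outside[OF w_in_B] by (metis eq_id_iff)
qed

lemma B_group_descent_cases:
  assumes "w \<in> B_group n" "n \<ge> 1"
  obtains (id) "w = id" | (descent) p q where "adjacent n p q" "w q < w p"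
proof -
  have "w p < w q \<or> w q < w p" if "adjacent n p q" for p q
    using that B_group_eq_iff[OF assms(1), of p q] adjacent_in_pm(3)[OF assms(2) that]
    by linarith
  then show ?thesis
    using B_group_mono_adjacent_imp_id[OF assms(1)] that by blast
qed

section \<open>Words and strong exchange\<close>

definition word_prod :: "(int \<Rightarrow> int) list \<Rightarrow> int \<Rightarrow> int" where
  "word_prod ss = foldr (\<circ>) ss id"

lemma word_prod_Nil: "word_prod [] = id"
  by (simp add: word_prod_def id_def)

lemma word_prod_Cons: "word_prod (s # ss) = s \<circ> word_prod ss"
  by (simp only: word_prod_def foldr.simps comp_apply)

lemma word_prod_snoc: "word_prod (ss @ [s]) = word_prod ss \<circ> s"
  by (induction ss)
    (simp_all only: append.simps word_prod_Cons word_prod_Nil comp_id id_comp comp_assoc)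

lemma word_prod_in_B_group: "n \<ge> 1 \<Longrightarrow> set ss \<subseteq> B_gens n \<Longrightarrow> word_prod ss \<in> B_group n"
proof (induction ss)
  case Nil
  show ?case by (simp only: word_prod_Nil id_in_B_group)
next
  case (Cons s ss)
  then show ?case
    unfolding word_prod_Cons using B_gens_subset_B_group by (intro comp_in_B_group) auto
qed

lemma B_gens_comp_eq_comp_reflection_if_inverts:
  assumes s_in_gens: "s \<in> B_gens n" and w_in_B: "w \<in> B_group n"
    and ab_in_pm: "a \<in> pm n" "b \<in> pm n"
    and ascent: "w a < w b" and inverted: "s (w b) < s (w a)"
  shows "s \<circ> w = w \<circ> reflection a b"
proof -
  obtain p q where adjacent_pq: "adjacent n p q" and s_eq: "s = reflection p q"
    using s_in_gens B_gens_iff by blast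
  have "w a \<noteq> 0" "w b \<noteq> 0"
    using B_group_in_pm_iff[OF w_in_B] ab_in_pm pm_nonzero by blast+
  then have "s = reflection (w a) (w b)"
    using reflection_eq_if_adjacent_inverts[OF adjacent_pq ascent] inverted by (simp add: s_eq)
  then show ?thesis
    using comp_reflection[OF w_in_B ab_in_pm] by simp
qed

text \<open>The letter of the word that inverts the pair \<open>(a, b)\<close> is deleted.\<close>

lemma word_exchange:
  assumes n_ge_1: "n \<ge> 1" and ab_in_pm: "a \<in> pm n" "b \<in> pm n" "a < b"
    and "set ss \<subseteq> B_gens n" "word_prod ss b < word_prod ss a"
  shows "\<exists>ss'. set ss' \<subseteq> B_gens n \<and> length ss' < length ss \<and>
    word_prod ss' = word_prod ss \<circ> reflection a b"
  using assms(5,6)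
proof (induction ss)
  case Nil
  then show ?case using ab_in_pm by (simp add: word_prod_Nil)
next
  case (Cons s ss)
  let ?w = "word_prod ss"
  have ss_in_gens: "set ss \<subseteq> B_gens n" and s_in_gens: "s \<in> B_gens n"
    using Cons.prems by auto
  have w_in_B: "?w \<in> B_group n"
    using word_prod_in_B_group n_ge_1 ss_in_gens by blast
  show ?case
  proof (cases "?w b < ?w a")
    case True
    then obtain ss' where ss'_word: "set ss' \<subseteq> B_gens n" "length ss' < length ss"
      "word_prod ss' = ?w \<circ> reflection a b"
      using Cons.IH ss_in_gens by blast
    have "word_prod (s # ss') = word_prod (s # ss) \<circ> reflection a b"
      unfolding word_prod_Cons ss'_word comp_assoc ..
    then show ?thesis
      using ss'_word s_in_gens by (intro exI[of _ "s # ss'"]) simp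
  next
    case False
    then have "?w a < ?w b"
      using B_group_eq_iff[OF w_in_B, of a b] ab_in_pm by simp
    moreover have "s (?w b) < s (?w a)"
      using Cons.prems(2) by (simp add: word_prod_Cons)
    ultimately have "word_prod (s # ss) = ?w \<circ> reflection a b"
      unfolding word_prod_Cons using B_gens_comp_eq_comp_reflection_if_inverts s_in_gens w_in_B
        ab_in_pm(1,2) by blast
    then have "word_prod (s # ss) \<circ> reflection a b = ?w"
      using comp_reflection_reflection ab_in_pm pm_nonzero by metis
    then show ?thesis
      using ss_in_gens by (intro exI[of _ ss]) simp
  qed
qed

section \<open>The rank function\<close>

definition rank :: "nat \<Rightarrow> (int \<Rightarrow> int) \<Rightarrow> int \<Rightarrow> int \<Rightarrow> int" where
  "rank n w i x = (\<Sum>a\<in>pm n. of_bool (a \<le> i \<and> x \<le> w a))"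

lemma rank_nonneg: "rank n w i x \<ge> 0"
  unfolding rank_def by (rule sum_nonneg) simp

lemma rank_mono_position: "i \<le> i' \<Longrightarrow> rank n w i x \<le> rank n w i' x"
  unfolding rank_def by (rule sum_mono) auto

lemma rank_eq_if_no_position_between:
  assumes "i \<le> i'" "\<And>a. a \<in> pm n \<Longrightarrow> i < a \<Longrightarrow> i' < a"
  shows "rank n w i' x = rank n w i x"
  unfolding rank_def using assms by (intro sum.cong) force+

lemma rank_position_step:
  assumes "i \<in> pm n"
  shows "rank n w i x = rank n w (i - 1) x + of_bool (x \<le> w i)"
proof -
  have "(\<Sum>a\<in>pm n - {i}. of_bool (a \<le> i \<and> x \<le> w a)) =
    (\<Sum>a\<in>pm n - {i}. of_bool (a \<le> i - 1 \<and> x \<le> w a) :: int)"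
    by (rule sum.cong) auto
  then show ?thesis
    unfolding rank_def sum.remove[OF finite_pm assms] by simp
qed

lemma rank_eq_card_values:
  assumes "w \<in> B_group n"
  shows "rank n w i x = int (card {y \<in> pm n. x \<le> y \<and> inv w y \<le> i})"
proof -
  have "bij_betw w {a \<in> pm n. a \<le> i \<and> x \<le> w a} {y \<in> pm n. x \<le> y \<and> inv w y \<le> i}"
    by (rule bij_betwI[where g = "inv w"])
      (auto simp: B_group_inverses[OF assms] B_group_in_pm_iff[OF assms]
        B_group_in_pm_iff[OF inv_in_B_group[OF assms]])
  then have "card {a \<in> pm n. a \<le> i \<and> x \<le> w a} = card {y \<in> pm n. x \<le> y \<and> inv w y \<le> i}"
    by (rule bij_betw_same_card)
  then show ?thesis
    by (simp add: rank_def finite_pm Int_def)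
qed

lemma rank_value_step:
  assumes "w \<in> B_group n" "x \<in> pm n"
  shows "rank n w i x = rank n w i (x + 1) + of_bool (inv w x \<le> i)"
proof -
  let ?V = "\<lambda>x. {y \<in> pm n. x \<le> y \<and> inv w y \<le> i}"
  have "?V x = (if inv w x \<le> i then insert x (?V (x + 1)) else ?V (x + 1))"
    using assms(2) by (auto simp: order.order_iff_strict)
  then have "card (?V x) = card (?V (x + 1)) + of_bool (inv w x \<le> i)"
    by (simp add: finite_pm)
  then show ?thesis
    by (simp add: rank_eq_card_values[OF assms(1)])
qed

lemma rank_comp_transpose:
  assumes "p \<in> pm n" "q \<in> pm n" "p < q" "w q < w p"
  shows "rank n (w \<circ> transpose p q) i x =
    rank n w i x - of_bool (p \<le> i \<and> i < q \<and> w q < x \<and> x \<le> w p)"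
proof -
  have split: "rank n f i x = of_bool (p \<le> i \<and> x \<le> f p) + of_bool (q \<le> i \<and> x \<le> f q) +
    (\<Sum>a\<in>pm n - {p} - {q}. of_bool (a \<le> i \<and> x \<le> f a))" for f
    unfolding rank_def using assms finite_pm
    by (subst sum.remove[of _ p], simp, simp, subst sum.remove[of _ q]) auto
  have "(\<Sum>a\<in>pm n - {p} - {q}. of_bool (a \<le> i \<and> x \<le> (w \<circ> transpose p q) a)) =
    (\<Sum>a\<in>pm n - {p} - {q}. of_bool (a \<le> i \<and> x \<le> w a) :: int)"
    by (rule sum.cong) (auto simp: transpose_def)
  then show ?thesis
    unfolding split using assms by auto
qed

lemma rank_comp_reflection:
  assumes "w \<in> B_group n" "p \<in> pm n" "q \<in> pm n" "p < q" "w q < w p"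
  shows "rank n (w \<circ> reflection p q) i x = rank n w i x
    - of_bool (p \<le> i \<and> i < q \<and> w q < x \<and> x \<le> w p)
    - of_bool (p \<noteq> - q \<and> - q \<le> i \<and> i < - p \<and> - w p < x \<and> x \<le> - w q)"
proof (cases "p = - q")
  case True
  then show ?thesis
    using rank_comp_transpose[OF assms(2-5)] by (simp add: reflection_def)
next
  case False
  let ?v = "w \<circ> transpose p q"
  have v_minus: "?v (- p) = - w p" "?v (- q) = - w q"
    using False assms B_group_minus[OF assms(1)] by (auto simp: transpose_def pm_iff)
  have "w \<circ> reflection p q = ?v \<circ> transpose (- q) (- p)"
    using False by (simp add: reflection_def stransp_def comp_assoc transpose_commute)
  then show ?thesis
    using rank_comp_transpose[of "- q" n "- p" ?v i x]
      rank_comp_transpose[OF assms(2-5), of i x]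
      v_minus assms False by (simp add: uminus_in_pm_iff)
qed

lemma rank_comp_reflection_le:
  assumes "w \<in> B_group n" "p \<in> pm n" "q \<in> pm n" "p < q" "w q < w p"
  shows "rank n (w \<circ> reflection p q) i x \<le> rank n w i x"
  using rank_comp_reflection[OF assms] by simp

lemma rank_symmetry:
  assumes "w \<in> B_group n"
  shows "rank n w i x - rank n w (- i - 1) (1 - x) =
    (\<Sum>a\<in>pm n. of_bool (- i \<le> a)) - (\<Sum>a\<in>pm n. of_bool (1 - x \<le> a))"
proof -
  have negate: "bij_betw uminus (pm n) (pm n)"
    by (rule bij_betwI[of _ _ _ uminus]) (auto simp: uminus_in_pm_iff)
  have permute: "bij_betw w (pm n) (pm n)"
    using assms B_group_permutes permutes_imp_bij by blast
  have "rank n w i x = (\<Sum>a\<in>pm n. of_bool (- a \<le> i \<and> x \<le> w (- a)))"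
    unfolding rank_def by (rule sum.reindex_bij_betw[OF negate, symmetric])
  also have "\<dots> = (\<Sum>a\<in>pm n. of_bool (- i \<le> a) - of_bool (1 - x \<le> w a)
      + of_bool (a \<le> - i - 1 \<and> 1 - x \<le> w a))"
    by (rule sum.cong) (auto simp: B_group_minus[OF assms])
  also have "\<dots> = (\<Sum>a\<in>pm n. of_bool (- i \<le> a)) - (\<Sum>a\<in>pm n. of_bool (1 - x \<le> w a))
      + rank n w (- i - 1) (1 - x)"
    by (simp only: rank_def sum.distrib sum_subtractf)
  also have "(\<Sum>a\<in>pm n. of_bool (1 - x \<le> w a)) = (\<Sum>a\<in>pm n. of_bool (1 - x \<le> a) :: int)"
    by (rule sum.reindex_bij_betw[OF permute])
  finally show ?thesis by simp
qed

text \<open>The condition on the signs of \<open>p\<close> and \<open>q\<close> keeps the rectangle on which the rank drops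
  disjoint from its mirror image.\<close>

lemma rank_le_comp_reflection:
  assumes u_in_B: "u \<in> B_group n" and v_in_B: "v \<in> B_group n"
    and pq_in_pm: "p \<in> pm n" "q \<in> pm n" "p < q" "0 < p \<or> q < 0 \<or> p = - q"
    and inverted: "v q < v p"
    and rank_le: "\<And>i x. rank n u i x \<le> rank n v i x"
    and rank_less: "\<And>i x. p \<le> i \<Longrightarrow> i < q \<Longrightarrow> v q < x \<Longrightarrow> x \<le> v p \<Longrightarrow> rank n u i x < rank n v i x"
  shows "rank n u i x \<le> rank n (v \<circ> reflection p q) i x"
proof -
  let ?rectangle = "p \<le> i \<and> i < q \<and> v q < x \<and> x \<le> v p"
  let ?mirror = "p \<noteq> - q \<and> - q \<le> i \<and> i < - p \<and> - v p < x \<and> x \<le> - v q"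
  have "rank n (v \<circ> reflection p q) i x = rank n v i x - of_bool ?rectangle - of_bool ?mirror"
    using rank_comp_reflection[OF v_in_B pq_in_pm(1-3) inverted] by simp
  moreover have "\<not> (?rectangle \<and> ?mirror)"
    using pq_in_pm by auto
  moreover have "rank n u i x < rank n v i x" if ?mirror
  proof -
    have "rank n u (- i - 1) (1 - x) < rank n v (- i - 1) (1 - x)"
      by (rule rank_less) (use that in auto)
    then show ?thesis
      using rank_symmetry[OF u_in_B, of i x] rank_symmetry[OF v_in_B, of i x] by simp
  qed
  ultimately show ?thesis
    using rank_le[of i x] rank_less[of i x] by auto
qed

lemma rank_le_id_imp_id:
  assumes u_in_B: "u \<in> B_group n" and rank_le: "\<And>i x. rank n u i x \<le> rank n id i x"
  shows "u = id"
proof -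
  have weak: "u a \<le> a" if "a \<in> pm n" for a
  proof (rule ccontr)
    assume "\<not> u a \<le> a"
    then have "rank n u a (a + 1) = rank n u (a - 1) (a + 1) + 1"
      using rank_position_step[OF that, of u "a + 1"] by simp
    moreover have "rank n id a (a + 1) = 0"
      unfolding rank_def by (rule sum.neutral) auto
    ultimately show False
      using rank_le[of a "a + 1"] rank_nonneg[of n u "a - 1" "a + 1"] by simp
  qed
  have "u a = a" if "a \<in> pm n" for a
    using weak[of a] weak[of "- a"] that B_group_minus[OF u_in_B, of a]
    by (simp add: uminus_in_pm_iff)
  then show ?thesis
    using B_group_outside[OF u_in_B] by (metis eq_id_iff)
qed

section \<open>Length\<close>

definition total_rank :: "nat \<Rightarrow> (int \<Rightarrow> int) \<Rightarrow> nat" where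
  "total_rank n w = nat (\<Sum>(i, x)\<in>pm n \<times> pm n. rank n w i x)"

lemma total_rank_comp_reflection_less:
  assumes "w \<in> B_group n" "p \<in> pm n" "q \<in> pm n" "p < q" "w q < w p"
  shows "total_rank n (w \<circ> reflection p q) < total_rank n w"
proof -
  let ?S = "\<lambda>w. \<Sum>(i, x)\<in>pm n \<times> pm n. rank n w i x"
  have "rank n (w \<circ> reflection p q) p (w p) < rank n w p (w p)"
    using rank_comp_reflection[OF assms, of p "w p"] assms by simp
  moreover have "(p, w p) \<in> pm n \<times> pm n"
    using assms B_group_in_pm_iff by auto
  ultimately have "?S (w \<circ> reflection p q) < ?S w"
    using rank_comp_reflection_le[OF assms] finite_pm
    by (intro sum_strict_mono_ex1) (auto simp: split_def simp del: o_apply)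
  moreover have "?S (w \<circ> reflection p q) \<ge> 0"
    by (intro sum_nonneg) (simp add: split_def rank_nonneg)
  ultimately show ?thesis
    unfolding total_rank_def by linarith
qed

lemma B_group_descent_induct [consumes 2, case_names id descent]:
  assumes n_ge_1: "n \<ge> 1" and w_in_B: "w \<in> B_group n"
    and "P id"
    and "\<And>w p q. w \<in> B_group n \<Longrightarrow> adjacent n p q \<Longrightarrow> w q < w p \<Longrightarrow>
      P (w \<circ> reflection p q) \<Longrightarrow> P w"
  shows "P w"
  using w_in_B
proof (induction "total_rank n w" arbitrary: w rule: less_induct)
  case less
  from less.prems n_ge_1 show ?case
  proof (cases rule: B_group_descent_cases)
    case id
    then show ?thesis
      using assms(3) by simp
  next
    case (descent p q)
    have "p \<in> pm n" "q \<in> pm n" "p < q"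
      using adjacent_in_pm n_ge_1 descent(1) by auto
    then have "P (w \<circ> reflection p q)"
      using less comp_reflection_in_B_group total_rank_comp_reflection_less descent(2) by blast
    then show ?thesis
      by (rule assms(4)[OF less.prems descent])
  qed
qed

lemma B_group_word:
  assumes n_ge_1: "n \<ge> 1" and "w \<in> B_group n"
  shows "\<exists>ss. set ss \<subseteq> B_gens n \<and> word_prod ss = w"
  using assms
proof (induction rule: B_group_descent_induct)
  case id
  show ?case
    by (intro exI[of _ "[]"]) (simp add: word_prod_Nil)
next
  case (descent w p q)
  then obtain ss where ss_word: "set ss \<subseteq> B_gens n" "word_prod ss = w \<circ> reflection p q"
    by blast
  have "word_prod (ss @ [reflection p q]) = w"
    unfolding word_prod_snoc ss_word
    using comp_reflection_reflection adjacent_in_pm[OF n_ge_1 descent.hyps(2)] pm_nonzero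
    by blast
  then show ?case
    using ss_word(1) descent.hyps(2) B_gens_iff
    by (intro exI[of _ "ss @ [reflection p q]"]) auto
qed

lemma B_length_comp_reflection_less:
  assumes n_ge_1: "n \<ge> 1" and w_in_B: "w \<in> B_group n"
    and ab_in_pm: "a \<in> pm n" "b \<in> pm n" "a < b" "w b < w a"
  shows "B_length n (w \<circ> reflection a b) < B_length n w"
proof -
  let ?expresses = "\<lambda>w l. \<exists>ss. set ss \<subseteq> B_gens n \<and> length ss = l \<and> word_prod ss = w"
  have length_eq: "B_length n w = (LEAST l. ?expresses w l)" for w
    by (simp only: B_length_def word_prod_def)
  have "\<exists>l. ?expresses w l"
    using B_group_word[OF n_ge_1 w_in_B] by auto
  then have "?expresses w (B_length n w)"
    unfolding length_eq by (rule LeastI_ex)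
  then obtain ss where "set ss \<subseteq> B_gens n" "length ss = B_length n w"
    "word_prod ss = w"
    by auto
  then obtain ss' where "set ss' \<subseteq> B_gens n" "length ss' < B_length n w"
    "word_prod ss' = w \<circ> reflection a b"
    using word_exchange[OF n_ge_1 ab_in_pm(1-3), of ss] ab_in_pm(4) by metis
  moreover from this have "B_length n (w \<circ> reflection a b) \<le> length ss'"
    unfolding length_eq by (intro Least_le) blast
  ultimately show ?thesis by simp
qed

lemma B_length_less_comp_reflection_iff:
  assumes n_ge_1: "n \<ge> 1" and u_in_B: "u \<in> B_group n"
    and ab_in_pm: "a \<in> pm n" "b \<in> pm n" "a < b"
  shows "B_length n u < B_length n (u \<circ> reflection a b) \<longleftrightarrow> u a < u b"
proof (cases "u a < u b")
  case True
  let ?w = "u \<circ> reflection a b"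
  have nonzero: "a \<noteq> 0" "b \<noteq> 0"
    using ab_in_pm pm_nonzero by auto
  have w_in_B: "?w \<in> B_group n"
    using comp_reflection_in_B_group u_in_B ab_in_pm by blast
  have "?w b < ?w a"
    using True nonzero ab_in_pm(3) by (simp add: reflection_apply)
  from B_length_comp_reflection_less[OF n_ge_1 w_in_B ab_in_pm this] show ?thesis
    using True by (simp only: comp_reflection_reflection[OF nonzero])
next
  case False
  then have "u b < u a"
    using B_group_eq_iff[OF u_in_B, of a b] ab_in_pm by simp
  from B_length_comp_reflection_less[OF n_ge_1 u_in_B ab_in_pm this] show ?thesis
    using False by simp
qed

section \<open>Bruhat order as domination of ranks\<close>

lemma bruhat_step_iff:
  assumes "n \<ge> 1" "u \<in> B_group n"
  shows "bruhat_step n u w \<longleftrightarrow>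
    (\<exists>a\<in>pm n. \<exists>b\<in>pm n. a < b \<and> u a < u b \<and> w = u \<circ> reflection a b)"
  unfolding bruhat_step_def Bex_def B_reflections_iff[OF assms(1)]
  using B_length_less_comp_reflection_iff[OF assms] by blast

lemma bruhat_step_in_B_group:
  "n \<ge> 1 \<Longrightarrow> u \<in> B_group n \<Longrightarrow> bruhat_step n u w \<Longrightarrow> w \<in> B_group n"
  using comp_reflection_in_B_group by (auto simp: bruhat_step_iff)

lemma bruhat_step_comp_descent:
  assumes "n \<ge> 1" "v \<in> B_group n" "a \<in> pm n" "b \<in> pm n" "a < b" "v b < v a"
  shows "bruhat_step n (v \<circ> reflection a b) v"
proof -
  have nonzero: "a \<noteq> 0" "b \<noteq> 0"
    using assms pm_nonzero by auto
  have "(v \<circ> reflection a b) a < (v \<circ> reflection a b) b"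
    using assms nonzero by (simp add: reflection_apply)
  moreover have "v = v \<circ> reflection a b \<circ> reflection a b"
    by (rule comp_reflection_reflection[OF nonzero, symmetric])
  moreover have "v \<circ> reflection a b \<in> B_group n"
    using comp_reflection_in_B_group assms by blast
  ultimately show ?thesis
    using assms bruhat_step_iff by blast
qed

lemma bruhat_le_refl: "u \<in> B_group n \<Longrightarrow> bruhat_le n u u"
  by (simp add: bruhat_le_def)

lemma bruhat_le_step:
  "n \<ge> 1 \<Longrightarrow> bruhat_le n u v \<Longrightarrow> bruhat_step n v w \<Longrightarrow> bruhat_le n u w"
  using bruhat_step_in_B_group by (auto simp: bruhat_le_def)

lemma bruhat_le_induct [consumes 2, case_names refl step]:
  assumes n_ge_1: "n \<ge> 1" and bruhat_le: "bruhat_le n u w"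
    and refl: "P u"
    and step: "\<And>v w. v \<in> B_group n \<Longrightarrow> bruhat_step n v w \<Longrightarrow> P v \<Longrightarrow> P w"
  shows "P w"
proof -
  have "(bruhat_step n)\<^sup>*\<^sup>* u w" "u \<in> B_group n"
    using bruhat_le by (auto simp: bruhat_le_def)
  then have "w \<in> B_group n \<and> P w"
    by (induction rule: rtranclp_induct)
      (use refl step bruhat_step_in_B_group[OF n_ge_1] in auto)
  then show ?thesis ..
qed

lemma bruhat_step_imp_rank_le:
  assumes n_ge_1: "n \<ge> 1" and u_in_B: "u \<in> B_group n" and step: "bruhat_step n u w"
  shows "rank n u i x \<le> rank n w i x"
proof -
  obtain a b where ab_in_pm: "a \<in> pm n" "b \<in> pm n" "a < b" "u a < u b"
    and w_eq: "w = u \<circ> reflection a b"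
    using step bruhat_step_iff[OF n_ge_1 u_in_B] by auto
  then have nonzero: "a \<noteq> 0" "b \<noteq> 0"
    using pm_nonzero by auto
  have "w b < w a"
    using ab_in_pm nonzero by (simp add: w_eq reflection_apply)
  moreover have "w \<in> B_group n"
    using bruhat_step_in_B_group n_ge_1 u_in_B step by blast
  ultimately have "rank n (w \<circ> reflection a b) i x \<le> rank n w i x"
    using rank_comp_reflection_le ab_in_pm by blast
  then show ?thesis
    by (simp only: w_eq comp_reflection_reflection[OF nonzero])
qed

lemma bruhat_le_imp_rank_le:
  assumes "n \<ge> 1" "bruhat_le n u w"
  shows "rank n u i x \<le> rank n w i x"
  using assms
proof (induction rule: bruhat_le_induct)
  case (step v w)
  then show ?case
    using bruhat_step_imp_rank_le[OF assms(1)] order_trans by blast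
qed simp

lemma bruhat_step_comp_adjacent:
  assumes n_ge_1: "n \<ge> 1" and u_in_B: "u \<in> B_group n" and adjacent_pq: "adjacent n p q"
    and step: "bruhat_step n u w" and neq: "w \<noteq> u \<circ> reflection p q"
  shows "bruhat_step n (u \<circ> reflection p q) (w \<circ> reflection p q)"
proof -
  let ?s = "reflection p q"
  have pq_in_pm: "p \<in> pm n" "q \<in> pm n"
    using adjacent_in_pm[OF n_ge_1 adjacent_pq] by auto
  then have s_in_B: "?s \<in> B_group n"
    by (rule reflection_in_B_group)
  have s_involutory: "?s (?s c) = c" for c
    using reflection_involutory pq_in_pm pm_nonzero by (metis comp_apply id_apply)
  obtain a b where ab_in_pm: "a \<in> pm n" "b \<in> pm n" "a < b" "u a < u b"
    and w_eq: "w = u \<circ> reflection a b"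
    using step bruhat_step_iff[OF n_ge_1 u_in_B] by auto
  have "\<not> ?s b < ?s a"
    using reflection_eq_if_adjacent_inverts[OF adjacent_pq ab_in_pm(3)] ab_in_pm pm_nonzero w_eq
      neq by auto
  then have "?s a < ?s b"
    using B_group_eq_iff[OF s_in_B, of a b] ab_in_pm by simp
  moreover have s_ab_in_pm: "?s a \<in> pm n" "?s b \<in> pm n"
    using B_group_in_pm_iff[OF s_in_B] ab_in_pm by auto
  moreover have "w \<circ> ?s = u \<circ> ?s \<circ> reflection (?s a) (?s b)"
    using comp_reflection[OF s_in_B s_ab_in_pm] by (simp only: w_eq s_involutory comp_assoc)
  ultimately show ?thesis
    using bruhat_step_iff[OF n_ge_1 comp_in_B_group[OF u_in_B s_in_B]] ab_in_pm(4) s_involutory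
    by (metis comp_apply)
qed

lemma bruhat_le_comp_adjacent:
  assumes n_ge_1: "n \<ge> 1" and adjacent_pq: "adjacent n p q" and bruhat_le: "bruhat_le n u w"
  shows "bruhat_le n (u \<circ> reflection p q) (w \<circ> reflection p q) \<or>
    bruhat_le n (u \<circ> reflection p q) w"
  using n_ge_1 bruhat_le
proof (induction rule: bruhat_le_induct)
  case refl
  have "u \<circ> reflection p q \<in> B_group n"
    using bruhat_le comp_reflection_in_B_group adjacent_in_pm[OF n_ge_1 adjacent_pq]
    by (auto simp: bruhat_le_def)
  then show ?case
    using bruhat_le_refl by blast
next
  case (step v w)
  then show ?case
    using bruhat_step_comp_adjacent[OF n_ge_1 _ adjacent_pq, of v w] bruhat_le_step[OF n_ge_1]
    by metis
qed

lemma rank_less_if_adjacent_ascent_descent: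
  assumes n_ge_1: "n \<ge> 1" and adjacent_pq: "adjacent n p q" and ascent: "u p < u q"
    and rank_le: "\<And>i x. rank n u i x \<le> rank n v i x"
    and i_range: "p \<le> i" "i < q" and x_range: "v q < x" "x \<le> v p"
  shows "rank n u i x < rank n v i x"
proof -
  have pq_in_pm: "p \<in> pm n" "q \<in> pm n" "p < q"
    using adjacent_in_pm[OF n_ge_1 adjacent_pq] by auto
  have rank_gap: "rank n w i x = rank n w p x" "rank n w (q - 1) x = rank n w p x" for w
    using i_range pq_in_pm adjacent_no_between[OF adjacent_pq]
    by (intro rank_eq_if_no_position_between; force)+
  have "rank n v p x = rank n v (p - 1) x + 1" "rank n v q x = rank n v p x"
    using rank_position_step pq_in_pm x_range rank_gap(2)[of v] by auto
  moreover have "rank n u p x = rank n u (p - 1) x + of_bool (x \<le> u p)"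
    "rank n u q x = rank n u p x + of_bool (x \<le> u q)"
    using rank_position_step pq_in_pm rank_gap(2)[of u] by auto
  ultimately show ?thesis
    unfolding rank_gap(1) using ascent rank_le[of "p - 1" x] rank_le[of q x]
    by (cases "x \<le> u p") auto
qed

lemma adjacent_rank_le_comp_reflection:
  assumes "n \<ge> 1" "u \<in> B_group n" "v \<in> B_group n"
    and adjacent_pq: "adjacent n p q" and "u p < u q" "v q < v p"
    and "\<And>i x. rank n u i x \<le> rank n v i x"
  shows "rank n u i x \<le> rank n (v \<circ> reflection p q) i x"
proof (rule rank_le_comp_reflection)
  show "0 < p \<or> q < 0 \<or> p = - q"
    using adjacent_pq by (auto simp: adjacent_def)
  show "rank n u i x < rank n v i x" if "p \<le> i" "i < q" "v q < x" "x \<le> v p" for i x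
    using rank_less_if_adjacent_ascent_descent assms that by blast
qed (use assms adjacent_in_pm in auto)

lemma bruhat_le_if_le_comp_descent:
  assumes n_ge_1: "n \<ge> 1" and v_in_B: "v \<in> B_group n" and descent: "adjacent n p q" "v q < v p"
    and bruhat_le: "bruhat_le n u (v \<circ> reflection p q)"
  shows "bruhat_le n u v"
  using bruhat_le_step[OF n_ge_1 bruhat_le]
    bruhat_step_comp_descent[OF n_ge_1 v_in_B adjacent_in_pm[OF n_ge_1 descent(1)] descent(2)]
  by blast

lemma bruhat_le_if_comp_adjacent_le_comp_descent:
  assumes n_ge_1: "n \<ge> 1" and v_in_B: "v \<in> B_group n" and descent: "adjacent n p q" "v q < v p"
    and bruhat_le: "bruhat_le n (u \<circ> reflection p q) (v \<circ> reflection p q)"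
  shows "bruhat_le n u v"
proof -
  have nonzero: "p \<noteq> 0" "q \<noteq> 0"
    using adjacent_in_pm[OF n_ge_1 descent(1)] pm_nonzero by auto
  have "bruhat_le n u v \<or> bruhat_le n u (v \<circ> reflection p q)"
    using bruhat_le_comp_adjacent[OF n_ge_1 descent(1) bruhat_le]
    by (simp only: comp_reflection_reflection[OF nonzero])
  then show ?thesis
    using bruhat_le_if_le_comp_descent[OF n_ge_1 v_in_B descent] by blast
qed

lemma rank_le_imp_bruhat_le:
  assumes n_ge_1: "n \<ge> 1" and u_in_B: "u \<in> B_group n" and v_in_B: "v \<in> B_group n"
    and rank_le: "\<And>i x. rank n u i x \<le> rank n v i x"
  shows "bruhat_le n u v"
  using n_ge_1 v_in_B u_in_B rank_le
proof (induction arbitrary: u rule: B_group_descent_induct)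
  case id
  then show ?case
    using rank_le_id_imp_id bruhat_le_refl by blast
next
  case (descent v p q)
  note u_in_B = descent.prems(1) and rank_le = descent.prems(2)
  have pq_in_pm: "p \<in> pm n" "q \<in> pm n" "p < q"
    using adjacent_in_pm n_ge_1 descent.hyps(2) by auto
  have below: "bruhat_le n u' (v \<circ> reflection p q)"
    if "u' \<in> B_group n" "u' p < u' q" "\<And>i x. rank n u' i x \<le> rank n v i x" for u'
    using descent.IH adjacent_rank_le_comp_reflection n_ge_1 descent.hyps that by blast
  show ?case
  proof (cases "u p < u q")
    case True
    then show ?thesis
      using below[OF u_in_B _ rank_le] bruhat_le_if_le_comp_descent[OF n_ge_1 descent.hyps]
      by blast
  next
    case False
    then have inverted: "u q < u p"
      using B_group_eq_iff[OF u_in_B, of p q] pq_in_pm by simp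
    have "rank n (u \<circ> reflection p q) i x \<le> rank n v i x" for i x
      using rank_comp_reflection_le[OF u_in_B pq_in_pm inverted] rank_le order_trans by blast
    moreover have "(u \<circ> reflection p q) p < (u \<circ> reflection p q) q"
      using inverted pq_in_pm by (simp add: reflection_apply pm_nonzero)
    moreover have "u \<circ> reflection p q \<in> B_group n"
      using comp_reflection_in_B_group u_in_B pq_in_pm by blast
    ultimately show ?thesis
      using below bruhat_le_if_comp_adjacent_le_comp_descent[OF n_ge_1 descent.hyps] by blast
  qed
qed

lemma bruhat_le_comp_reflection:
  assumes n_ge_1: "n \<ge> 1" and bruhat_le: "bruhat_le n u v"
    and pq_in_pm: "p \<in> pm n" "q \<in> pm n" "p < q" "0 < p \<or> q < 0 \<or> p = - q"
    and inverted: "v q < v p"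
    and rank_less: "\<And>i x. p \<le> i \<Longrightarrow> i < q \<Longrightarrow> v q < x \<Longrightarrow> x \<le> v p \<Longrightarrow> rank n u i x < rank n v i x"
  shows "bruhat_le n u (v \<circ> reflection p q)"
proof (rule rank_le_imp_bruhat_le[OF n_ge_1])
  show u_in_B: "u \<in> B_group n" and "v \<circ> reflection p q \<in> B_group n"
    using bruhat_le comp_reflection_in_B_group pq_in_pm by (auto simp: bruhat_le_def)
  show "rank n u i x \<le> rank n (v \<circ> reflection p q) i x" for i x
  proof (rule rank_le_comp_reflection)
    show "v \<in> B_group n"
      using bruhat_le by (simp add: bruhat_le_def)
    show "rank n u i x \<le> rank n v i x" for i x
      by (rule bruhat_le_imp_rank_le[OF n_ge_1 bruhat_le])
  qed (use u_in_B pq_in_pm inverted rank_less in auto)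
qed

section \<open>Value pairs and parity of ranks\<close>

lemma even_card_if_fixpoint_free_involution:
  assumes "\<And>x. x \<in> A \<Longrightarrow> h x \<in> A" "\<And>x. x \<in> A \<Longrightarrow> h (h x) = x" "\<And>x. x \<in> A \<Longrightarrow> h x \<noteq> x"
  shows "even (card A)"
proof -
  have "(\<Sum>x\<in>A. 1 :: bit) = 0"
    by (rule sum_involution_eq_0[where h = h]) (use assms in auto)
  then have "(of_nat (card A) :: bit) = 0"
    by simp
  then show ?thesis
    by (metis even_of_nat dvd_0_right)
qed

text \<open>The odd involution extending \<open>a \<mapsto> a\<^sup>*\<close>; its orbits are
  \<open>{2k - 1, 2k}\<close> and their negatives.\<close>

definition mate :: "int \<Rightarrow> int" where
  "mate y = (if (0 < y) = even y then y - 1 else y + 1)"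

lemma mate_mate: "y \<noteq> 0 \<Longrightarrow> mate (mate y) = y"
  unfolding mate_def by presburger

lemma mate_neq: "mate y \<noteq> y"
  by (simp add: mate_def)

lemma mate_minus: "y \<noteq> 0 \<Longrightarrow> mate (- y) = - mate y"
  by (auto simp: mate_def)

lemma mate_eq_star: "0 < a \<Longrightarrow> a < int n \<Longrightarrow> mate a = star n a"
  by (auto simp: star_def mate_def)

definition paired :: "nat \<Rightarrow> int set" where
  "paired n = pm n - {int n, - int n}"

lemma paired_iff: "y \<in> paired n \<longleftrightarrow> y \<noteq> 0 \<and> \<bar>y\<bar> < int n"
  by (auto simp: paired_def pm_iff)

lemma paired_imp_pm: "y \<in> paired n \<Longrightarrow> y \<in> pm n"
  by (auto simp: paired_def)

lemma paired_nonzero: "y \<in> paired n \<Longrightarrow> y \<noteq> 0"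
  by (simp add: paired_iff)

lemma mate_in_paired:
  assumes "odd n" "y \<in> paired n"
  shows "mate y \<in> paired n"
proof -
  have "odd (int n)" "y \<noteq> 0" "- int n < y" "y < int n"
    using assms by (auto simp: paired_iff)
  then have "mate y \<noteq> 0 \<and> - int n < mate y \<and> mate y < int n"
    by (cases "(0 < y) = even y") (simp_all add: mate_def, presburger+)
  then show ?thesis
    by (auto simp: paired_iff)
qed

text \<open>The hypothesis \<open>x < mate x\<close> is the form in which we require that a threshold \<open>x\<close>
  separates no pair.\<close>

lemma le_mate: "x < mate x \<Longrightarrow> y \<noteq> 0 \<Longrightarrow> x \<le> y \<Longrightarrow> x \<le> mate y"
  unfolding mate_def by presburger

lemma max_mate_plus_1_less_mate: "y \<noteq> 0 \<Longrightarrow> max y (mate y) + 1 < mate (max y (mate y) + 1)"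
  by (cases "(0 < y) = even y") (auto simp: mate_def split: if_splits)

lemma W_set_in_B_group: "w \<in> W_set n \<Longrightarrow> w \<in> B_group n"
  by (simp add: W_set_def)

lemma W_set_mate_adjacent:
  assumes w_in_W: "w \<in> W_set n" and y_paired: "y \<in> paired n"
  shows "\<bar>inv w y - inv w (mate y)\<bar> \<le> 1"
proof -
  have positive: "\<bar>inv w a - inv w (mate a)\<bar> \<le> 1" if "0 < a" "a < int n" for a
    using w_in_W that by (simp add: W_set_def mate_eq_star)
  show ?thesis
  proof (cases "0 < y")
    case True
    then show ?thesis
      using positive y_paired by (simp add: paired_iff)
  next
    case False
    have "inv w (- a) = - inv w a" for a
      using B_group_minus inv_in_B_group W_set_in_B_group w_in_W by blast
    then show ?thesis
      using positive[of "- y"] y_paired False by (simp add: paired_iff mate_minus)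
  qed
qed

definition mated :: "nat \<Rightarrow> (int \<Rightarrow> int) \<Rightarrow> int \<Rightarrow> bool" where
  "mated n w i \<longleftrightarrow> w i \<in> paired n \<and> w (i + 1) = mate (w i)"

lemma mated_Suc_in_paired: "odd n \<Longrightarrow> mated n w i \<Longrightarrow> w (i + 1) \<in> paired n"
  using mate_in_paired by (simp add: mated_def)

lemma mated_imp_not_mated_Suc:
  assumes "w \<in> B_group n" "mated n w i"
  shows "\<not> mated n w (i + 1)"
proof
  assume "mated n w (i + 1)"
  then have "w (i + 2) = w i"
    using assms(2) mate_mate[of "w i"] by (simp add: mated_def paired_iff add.assoc)
  then show False
    using B_group_eq_iff[OF assms(1)] by simp
qed

lemma W_set_mated_cases:
  assumes odd_n: "odd n" and w_in_W: "w \<in> W_set n" and w_i_paired: "w i \<in> paired n"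
  shows "mated n w i \<or> mated n w (i - 1)"
proof -
  note inverses = B_group_inverses[OF W_set_in_B_group[OF w_in_W]]
  have "\<bar>i - inv w (mate (w i))\<bar> \<le> 1"
    using W_set_mate_adjacent[OF w_in_W w_i_paired] by (simp add: inverses)
  moreover have "inv w (mate (w i)) \<noteq> i"
    using inverses(1)[of "mate (w i)"] mate_neq[of "w i"] by metis
  ultimately have "inv w (mate (w i)) = i + 1 \<or> inv w (mate (w i)) = i - 1"
    by linarith
  then have "w (i + 1) = mate (w i) \<or> w (i - 1) = mate (w i)"
    using inverses(1) by metis
  then show ?thesis
    using w_i_paired mate_mate[of "w i"] mate_in_paired[OF odd_n w_i_paired]
    by (auto simp: mated_def paired_nonzero)
qed

lemma W_set_mated_if_cut_separates_mates:
  assumes w_in_W: "w \<in> W_set n" and y_paired: "y \<in> paired n"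
    and cut: "inv w y \<le> i" "i < inv w (mate y)"
  shows "w i = y" "mated n w i"
proof -
  note inverses = B_group_inverses[OF W_set_in_B_group[OF w_in_W]]
  have "inv w y = i" "inv w (mate y) = i + 1"
    using W_set_mate_adjacent[OF w_in_W y_paired] cut by linarith+
  then show "w i = y" "mated n w i"
    using y_paired inverses(1)[of y] inverses(1)[of "mate y"] by (simp_all add: mated_def)
qed

lemma W_set_mate_cut_iff:
  assumes odd_n: "odd n" and w_in_W: "w \<in> W_set n" and y_paired: "y \<in> paired n"
    and "\<not> mated n w i"
  shows "inv w (mate y) \<le> i \<longleftrightarrow> inv w y \<le> i"
  using W_set_mated_if_cut_separates_mates[OF w_in_W y_paired, of i]
    W_set_mated_if_cut_separates_mates[OF w_in_W mate_in_paired[OF odd_n y_paired], of i]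
    assms(4) mate_mate[OF paired_nonzero[OF y_paired]] by force

lemma W_set_even_card_between_cuts:
  assumes odd_n: "odd n" and w_in_W: "w \<in> W_set n" and cuts: "\<not> mated n w i" "\<not> mated n w i'"
    and all_paired: "\<And>a. a \<in> {i<..i'} \<Longrightarrow> w a \<in> paired n"
  shows "even (card {i<..i'})"
proof (rule even_card_if_fixpoint_free_involution)
  note inverses = B_group_inverses[OF W_set_in_B_group[OF w_in_W]]
  let ?partner = "\<lambda>a. inv w (mate (w a))"
  fix a assume a_between: "a \<in> {i<..i'}"
  note w_a_paired = all_paired[OF a_between]
  show "?partner a \<in> {i<..i'}"
    using W_set_mate_cut_iff[OF odd_n w_in_W w_a_paired] cuts a_between
    by (simp add: inverses flip: not_le)
  show "?partner (?partner a) = a"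
    using mate_mate[OF paired_nonzero[OF w_a_paired]] by (simp add: inverses)
  show "?partner a \<noteq> a"
    using mate_neq[of "w a"] inverses(1) by metis
qed

lemma W_set_odd_inv_top:
  assumes odd_n: "odd n" and w_in_W: "w \<in> W_set n"
  shows "odd (inv w (int n))"
proof -
  note w_in_B = W_set_in_B_group[OF w_in_W]
  define q where "q = \<bar>inv w (int n)\<bar>"
  have abs_w_q: "\<bar>w q\<bar> = int n"
    by (simp add: q_def abs_if B_group_minus[OF w_in_B] B_group_inverses[OF w_in_B])
  have "inv w (int n) \<in> pm n"
    using B_group_in_pm_iff[OF inv_in_B_group[OF w_in_B]] odd_n by (auto simp: pm_iff odd_pos)
  then have q_range: "0 < q" "q \<le> int n"
    by (auto simp: q_def pm_iff)
  have "even (card {0<..q - 1})"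
  proof (rule W_set_even_card_between_cuts[OF odd_n w_in_W])
    show "\<not> mated n w 0"
      using B_group_zero[OF w_in_B] by (simp add: mated_def paired_iff)
    show "\<not> mated n w (q - 1)"
      using mated_Suc_in_paired[OF odd_n, of w "q - 1"] abs_w_q by (auto simp: paired_iff)
    fix a assume "a \<in> {0<..q - 1}"
    then have "w a \<in> pm n" "w a \<noteq> w q" "w a \<noteq> w (- q)"
      using q_range B_group_in_pm_iff[OF w_in_B] B_group_eq_iff[OF w_in_B]
      by (auto simp: pm_iff)
    then show "w a \<in> paired n"
      using abs_w_q B_group_minus[OF w_in_B] by (auto simp: pm_iff paired_iff)
  qed
  then have "odd q"
    using q_range(1) by (simp add: even_nat_iff)
  then show ?thesis
    by (simp add: q_def)
qed

definition paired_quadrant :: "nat \<Rightarrow> (int \<Rightarrow> int) \<Rightarrow> int \<Rightarrow> int \<Rightarrow> int set" where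
  "paired_quadrant n w i x = {y \<in> paired n. x \<le> y \<and> inv w y \<le> i}"

lemma rank_eq_card_paired_quadrant:
  assumes w_in_B: "w \<in> B_group n" and x_range: "- int n < x" "x \<le> int n"
  shows "rank n w i x = int (card (paired_quadrant n w i x)) + of_bool (inv w (int n) \<le> i)"
proof -
  have "y = int n \<or> y \<in> paired n" if "y \<in> pm n" "x \<le> y" for y
    using x_range that by (auto simp: paired_def)
  moreover have "int n \<in> pm n"
    using x_range by (simp add: pm_iff)
  ultimately have "{y \<in> pm n. x \<le> y \<and> inv w y \<le> i} =
    (if inv w (int n) \<le> i then insert (int n) (paired_quadrant n w i x)
     else paired_quadrant n w i x)"
    using x_range(2) paired_imp_pm unfolding paired_quadrant_def by auto
  moreover have "int n \<notin> paired_quadrant n w i x" "finite (paired_quadrant n w i x)"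
    by (simp_all add: paired_quadrant_def paired_def finite_pm)
  ultimately show ?thesis
    by (simp add: rank_eq_card_values[OF w_in_B])
qed

lemma W_set_mate_in_paired_quadrant:
  assumes odd_n: "odd n" and w_in_W: "w \<in> W_set n"
    and x_threshold: "x < mate x" "mated n w i \<Longrightarrow> w i < x"
    and y_in_quadrant: "y \<in> paired_quadrant n w i x"
  shows "mate y \<in> paired_quadrant n w i x"
proof -
  have y_paired: "y \<in> paired n" and "x \<le> y" "inv w y \<le> i"
    using y_in_quadrant by (auto simp: paired_quadrant_def)
  moreover have "inv w (mate y) \<le> i"
    using W_set_mated_if_cut_separates_mates[OF w_in_W y_paired \<open>inv w y \<le> i\<close>] x_threshold(2)
      \<open>x \<le> y\<close> by force
  ultimately show ?thesis
    using mate_in_paired[OF odd_n y_paired] le_mate[OF x_threshold(1)]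
    by (simp add: paired_quadrant_def paired_nonzero)
qed

lemma W_set_even_rank_iff:
  assumes odd_n: "odd n" and w_in_W: "w \<in> W_set n"
    and x_threshold: "x < mate x" "mated n w i \<Longrightarrow> w i < x"
    and x_range: "- int n < x" "x \<le> int n"
  shows "even (rank n w i x) \<longleftrightarrow> i < inv w (int n)"
proof -
  have "even (card (paired_quadrant n w i x))"
  proof (rule even_card_if_fixpoint_free_involution)
    fix y assume "y \<in> paired_quadrant n w i x"
    then show "mate y \<in> paired_quadrant n w i x" "mate (mate y) = y" "mate y \<noteq> y"
      using W_set_mate_in_paired_quadrant[OF odd_n w_in_W x_threshold] mate_mate mate_neq
      by (auto simp: paired_quadrant_def paired_nonzero)
  qed
  then show ?thesis
    by (auto simp: rank_eq_card_paired_quadrant[OF W_set_in_B_group[OF w_in_W] x_range])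
qed

lemma W_set_rank_average:
  assumes odd_n: "odd n" and w_in_W: "w \<in> W_set n"
    and x_upper: "x \<in> paired n" "mate x = x - 1" "mated n w i \<Longrightarrow> w i < x - 1"
  shows "2 * rank n w i x = rank n w i (x - 1) + rank n w i (x + 1)"
proof -
  note w_in_B = W_set_in_B_group[OF w_in_W]
  have pred_x_paired: "x - 1 \<in> paired n"
    using mate_in_paired[OF odd_n x_upper(1)] x_upper(2) by simp
  have "mate (x - 1) = x"
    using mate_mate[OF paired_nonzero[OF x_upper(1)]] x_upper(2) by simp
  then have "inv w x \<le> i \<longleftrightarrow> inv w (x - 1) \<le> i"
    using W_set_mate_in_paired_quadrant[OF odd_n w_in_W _ x_upper(3), of x]
      W_set_mate_in_paired_quadrant[OF odd_n w_in_W _ x_upper(3), of "x - 1"] x_upper(1,2)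
        pred_x_paired
    by (auto simp: paired_quadrant_def)
  then show ?thesis
    using rank_value_step[OF w_in_B, of x i] rank_value_step[OF w_in_B, of "x - 1" i] x_upper(1)
      pred_x_paired
    by (simp add: paired_imp_pm)
qed

section \<open>Passing to \<open>c(v)\<close>\<close>

locale W_set_bruhat_pair =
  fixes n :: nat and u v :: "int \<Rightarrow> int"
  assumes odd_n: "odd n" and u_in_W_set: "u \<in> W_set n" and v_in_W_set: "v \<in> W_set n"
    and bruhat_le: "bruhat_le n u v" and inv_top_less: "inv v (int n) < inv u (int n)"
begin

definition pos_v :: int where "pos_v = inv v (int n)"

definition pos_u :: int where "pos_u = inv u (int n)"

lemma n_ge_1: "n \<ge> 1"
  using odd_pos[OF odd_n] by simp

lemma u_in_B_group: "u \<in> B_group n" and v_in_B_group: "v \<in> B_group n"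
  by (simp_all add: W_set_in_B_group u_in_W_set v_in_W_set)

lemma rank_le: "rank n u i x \<le> rank n v i x"
  using bruhat_le_imp_rank_le[OF n_ge_1 bruhat_le] .

lemma u_pos_u: "u pos_u = int n" and v_pos_v: "v pos_v = int n"
  by (simp_all add: pos_v_def pos_u_def
    B_group_inverses[OF u_in_B_group] B_group_inverses[OF v_in_B_group])

lemma odd_pos_v: "odd pos_v" and odd_pos_u: "odd pos_u"
  by (simp_all add: pos_v_def pos_u_def W_set_odd_inv_top odd_n u_in_W_set v_in_W_set)

lemma pos_v_less_pos_u: "pos_v < pos_u"
  using inv_top_less by (simp add: pos_v_def pos_u_def)

lemma positions_after_pos_v:
  assumes "pos_v \<noteq> - 1"
  shows "pos_v \<in> pm n" "pos_v + 1 \<in> pm n" "pos_v + 2 \<in> pm n" "0 < pos_v \<or> pos_v + 2 < 0"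
proof -
  have "pos_v \<in> pm n" "pos_u \<in> pm n"
    using B_group_in_pm_iff[OF v_in_B_group, of pos_v]
      B_group_in_pm_iff[OF u_in_B_group, of pos_u]
      u_pos_u v_pos_v n_ge_1 by (auto simp: pm_iff)
  then have "\<bar>pos_v\<bar> \<le> int n" "pos_v < int n"
    using pos_v_less_pos_u by (auto simp: pm_iff)
  moreover have "0 < pos_v \<or> pos_v + 2 < 0"
    using assms odd_pos_v by presburger
  moreover have "pos_v + 2 \<le> int n"
  proof -
    have "odd (int n)"
      using odd_n by simp
    then show ?thesis
      using \<open>pos_v < int n\<close> odd_pos_v by presburger
  qed
  ultimately show "pos_v \<in> pm n" "pos_v + 1 \<in> pm n" "pos_v + 2 \<in> pm n"
    "0 < pos_v \<or> pos_v + 2 < 0"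
    by (auto simp: pm_iff)
qed

lemma rank_less_at_unseparating_threshold:
  assumes i_range: "pos_v \<le> i" "i < pos_u"
    and x_threshold: "x < mate x" "mated n u i \<Longrightarrow> u i < x" "mated n v i \<Longrightarrow> v i < x"
    and x_range: "- int n < x" "x \<le> int n"
  shows "rank n u i x < rank n v i x"
proof -
  have "even (rank n u i x)" "odd (rank n v i x)"
    using W_set_even_rank_iff[OF odd_n u_in_W_set x_threshold(1,2) x_range]
      W_set_even_rank_iff[OF odd_n v_in_W_set x_threshold(1,3) x_range] i_range
    by (simp_all add: pos_v_def pos_u_def)
  then have "rank n u i x \<noteq> rank n v i x"
    by metis
  then show ?thesis
    using rank_le[of i x] by simp
qed

lemma rank_less_above_unseparating_threshold:
  assumes i_range: "pos_v \<le> i" "i < pos_u"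
    and y_threshold: "y < mate y" "mated n u i \<Longrightarrow> u i < y" "mated n v i \<Longrightarrow> v i < y"
    and xy_range: "- int n < y" "y \<le> x" "x \<le> int n"
  shows "rank n u i x < rank n v i x"
proof -
  have unseparated: "rank n u i z < rank n v i z" if "z < mate z" "y \<le> z" "z \<le> int n" for z
    using rank_less_at_unseparating_threshold[OF i_range that(1)] y_threshold(2,3) xy_range(1)
      that by force
  show ?thesis
  proof (cases "x < mate x")
    case True
    then show ?thesis
      using unseparated xy_range by simp
  next
    case False
    then have mate_x: "mate x = x - 1" and "y \<noteq> x"
      using y_threshold(1) by (auto simp: mate_def split: if_splits)
    have "x \<noteq> int n" "x \<noteq> 0"
      using mate_x odd_n n_ge_1 by (auto simp: mate_def split: if_splits)
    then have x_paired: "x \<in> paired n"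
      using xy_range by (simp add: paired_iff)
    have "x - 1 < mate (x - 1)" "x + 1 < mate (x + 1)"
      using mate_x \<open>x \<noteq> 0\<close> unfolding mate_def by presburger+
    then have "rank n u i (x - 1) < rank n v i (x - 1)"
      "rank n u i (x + 1) < rank n v i (x + 1)"
      using unseparated xy_range \<open>y \<noteq> x\<close> \<open>x \<noteq> int n\<close> by auto
    moreover have "2 * rank n u i x = rank n u i (x - 1) + rank n u i (x + 1)"
      by (rule W_set_rank_average[OF odd_n u_in_W_set x_paired mate_x])
        (use xy_range y_threshold \<open>y \<noteq> x\<close> in force)
    moreover have "2 * rank n v i x = rank n v i (x - 1) + rank n v i (x + 1)"
      by (rule W_set_rank_average[OF odd_n v_in_W_set x_paired mate_x])
        (use xy_range y_threshold \<open>y \<noteq> x\<close> in force)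
    ultimately show ?thesis by linarith
  qed
qed

lemma rank_less_if_not_mated:
  assumes "pos_v \<le> i" "i < pos_u" "\<not> mated n u i" "\<not> mated n v i" "- int n < x" "x \<le> int n"
  shows "rank n u i x < rank n v i x"
proof (rule rank_less_above_unseparating_threshold)
  show "1 - int n < mate (1 - int n)"
    using odd_n n_ge_1 by (simp add: mate_def)
qed (use assms in auto)

lemma bruhat_le_c_op_if_minus_one:
  assumes "pos_v = - 1"
  shows "bruhat_le n u (c_op n v)"
proof -
  have "v 1 = - int n"
    using B_group_minus[OF v_in_B_group, of pos_v] v_pos_v assms by simp
  have "bruhat_le n u (v \<circ> reflection (- 1) 1)"
  proof (rule bruhat_le_comp_reflection[OF n_ge_1 bruhat_le])
    fix i x :: int
    assume i_range: "- 1 \<le> i" "i < 1" and x_range: "v 1 < x" "x \<le> v (- 1)"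
    have "rank n w i x = rank n w (- 1) x" for w
      by (rule rank_eq_if_no_position_between) (use i_range in \<open>auto simp: pm_iff\<close>)
    moreover have "\<not> mated n u (- 1)"
      using mated_Suc_in_paired[OF odd_n, of u "- 1"] B_group_zero[OF u_in_B_group]
      by (auto simp: paired_iff)
    moreover have "\<not> mated n v (- 1)"
      using v_pos_v assms by (simp add: mated_def paired_iff)
    ultimately show "rank n u i x < rank n v i x"
      using rank_less_if_not_mated[of "- 1" x] pos_v_less_pos_u assms x_range \<open>v 1 = - int n\<close>
        v_pos_v by simp
  qed (use n_ge_1 v_pos_v assms \<open>v 1 = - int n\<close> in \<open>auto simp: pm_iff\<close>)
  then show ?thesis
    using assms by (simp add: c_op_def Let_def pos_v_def reflection_def transpose_commute)
qed

lemma mated_after_pos_v: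
  assumes "pos_v \<noteq> - 1"
  shows "mated n v (pos_v + 1)"
proof -
  have "v (pos_v + 1) \<in> pm n"
    using B_group_in_pm_iff[OF v_in_B_group] positions_after_pos_v(2)[OF assms] by simp
  moreover have "v (pos_v + 1) \<noteq> v pos_v" "v (pos_v + 1) \<noteq> v (- pos_v)"
    using B_group_eq_iff[OF v_in_B_group] odd_pos_v by presburger+
  ultimately have "v (pos_v + 1) \<in> paired n"
    using v_pos_v B_group_minus[OF v_in_B_group, of pos_v] by (auto simp: pm_iff paired_iff)
  moreover have "\<not> mated n v pos_v"
    using v_pos_v by (simp add: mated_def paired_iff)
  ultimately show ?thesis
    using W_set_mated_cases[OF odd_n v_in_W_set, of "pos_v + 1"] by simp
qed

lemma rank_less_after_pos_v:
  assumes not_minus_one: "pos_v \<noteq> - 1"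
    and x_range: "v (pos_v + 1) < x" "v (pos_v + 2) < x" "x \<le> int n"
  shows "rank n u (pos_v + 1) x < rank n v (pos_v + 1) x"
proof -
  note v_mated = mated_after_pos_v[OF not_minus_one]
  have v_mate: "v (pos_v + 2) = mate (v (pos_v + 1))"
    using v_mated by (simp add: mated_def add.assoc)
  have values_paired: "v (pos_v + 1) \<in> paired n" "v (pos_v + 2) \<in> paired n"
    using v_mated mated_Suc_in_paired[OF odd_n v_mated] by (simp_all add: mated_def add.assoc)
  have "pos_v + 1 < pos_u"
    using pos_v_less_pos_u odd_pos_v odd_pos_u by presburger
  show ?thesis
  proof (cases "mated n u (pos_v + 1)")
    case True
    have "pos_u \<noteq> pos_v + 2"
      using mated_Suc_in_paired[OF odd_n True] u_pos_u by (auto simp: paired_iff add.assoc)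
    then have "pos_v + 2 < pos_u"
      using \<open>pos_v + 1 < pos_u\<close> by simp
    moreover have "\<not> mated n u (pos_v + 2)" "\<not> mated n v (pos_v + 2)"
      using mated_imp_not_mated_Suc u_in_B_group v_in_B_group True v_mated
      by (fastforce simp: add.assoc)+
    ultimately have "rank n u (pos_v + 2) x < rank n v (pos_v + 2) x"
      using values_paired x_range by (intro rank_less_if_not_mated) (auto simp: paired_iff)
    moreover have "rank n v (pos_v + 2) x = rank n v (pos_v + 1) x"
      using rank_position_step[OF positions_after_pos_v(3)[OF not_minus_one], of v x] x_range
      by (simp add: add.commute)
    moreover have "rank n u (pos_v + 1) x \<le> rank n u (pos_v + 2) x"
      by (rule rank_mono_position) simp
    ultimately show ?thesis by linarith
  next
    case False
    define y where "y = max (v (pos_v + 1)) (v (pos_v + 2)) + 1"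
    show ?thesis
    proof (rule rank_less_above_unseparating_threshold)
      show "y < mate y"
        unfolding y_def v_mate using values_paired(1)
        by (intro max_mate_plus_1_less_mate paired_nonzero)
    qed (use \<open>pos_v + 1 < pos_u\<close> False values_paired x_range in \<open>auto simp: y_def paired_iff\<close>)
  qed
qed

lemma bruhat_le_c_op_if_descent:
  assumes not_minus_one: "pos_v \<noteq> - 1" and descent: "v (pos_v + 2) < v (pos_v + 1)"
  shows "bruhat_le n u (c_op n v)"
proof -
  note positions = positions_after_pos_v[OF not_minus_one]
  define y where "y = v (pos_v + 1)"
  have "mated n v (pos_v + 1)"
    by (rule mated_after_pos_v[OF not_minus_one])
  then have y_upper: "y \<in> paired n" "v (pos_v + 2) = y - 1"
    using descent by (auto simp: y_def mated_def mate_def add.assoc split: if_splits)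
  have "rank n u (pos_v + 1) (y + 1) < rank n v (pos_v + 1) (y + 1)"
    using rank_less_after_pos_v[OF not_minus_one, of "y + 1"] y_upper
    by (auto simp: y_def paired_iff)
  moreover have "inv v y = pos_v + 1" "y \<in> pm n"
    using y_upper(1) paired_imp_pm B_group_inverses[OF v_in_B_group] by (auto simp: y_def)
  ultimately have rank_less: "rank n u (pos_v + 1) y < rank n v (pos_v + 1) y"
    using rank_value_step[OF u_in_B_group, of y "pos_v + 1"]
      rank_value_step[OF v_in_B_group, of y "pos_v + 1"]
    by simp
  have "bruhat_le n u (v \<circ> reflection (pos_v + 1) (pos_v + 2))"
  proof (rule bruhat_le_comp_reflection[OF n_ge_1 bruhat_le])
    fix i x
    assume "pos_v + 1 \<le> i" "i < pos_v + 2" "v (pos_v + 2) < x" "x \<le> v (pos_v + 1)"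
    then have "i = pos_v + 1" "x = y"
      using y_upper(2) by (auto simp: y_def)
    then show "rank n u i x < rank n v i x"
      using rank_less by simp
  qed (use positions descent in auto)
  moreover have "c_op n v = v \<circ> reflection (pos_v + 1) (pos_v + 2)"
    using assms odd_pos_v by (auto simp: c_op_def Let_def reflection_def simp flip: pos_v_def)
  ultimately show ?thesis by simp
qed

lemma bruhat_le_c_op_if_ascent:
  assumes not_minus_one: "pos_v \<noteq> - 1" and ascent: "v (pos_v + 1) < v (pos_v + 2)"
  shows "bruhat_le n u (c_op n v)"
proof -
  note positions = positions_after_pos_v[OF not_minus_one]
  have "bruhat_le n u (v \<circ> reflection pos_v (pos_v + 2))"
  proof (rule bruhat_le_comp_reflection[OF n_ge_1 bruhat_le])
    have "v (pos_v + 2) \<in> paired n"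
      using mated_Suc_in_paired[OF odd_n mated_after_pos_v[OF not_minus_one]]
      by (simp add: add.assoc)
    then show "v (pos_v + 2) < v pos_v"
      using v_pos_v by (auto simp: paired_iff)
    fix i x
    assume i_range: "pos_v \<le> i" "i < pos_v + 2" and x_range: "v (pos_v + 2) < x" "x \<le> v pos_v"
    have "rank n u i x \<le> rank n u (pos_v + 1) x"
      using i_range by (intro rank_mono_position) simp
    also have "\<dots> < rank n v (pos_v + 1) x"
      using rank_less_after_pos_v[OF not_minus_one] ascent x_range v_pos_v by simp
    also have "\<dots> = rank n v pos_v x"
      using rank_position_step[OF positions(2), of v x] ascent x_range by simp
    also have "\<dots> \<le> rank n v i x"
      using i_range by (intro rank_mono_position)
    finally show "rank n u i x < rank n v i x" .
  qed (use positions in auto)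
  moreover have "c_op n v = v \<circ> reflection pos_v (pos_v + 2)"
    using assms by (auto simp: c_op_def Let_def reflection_def simp flip: pos_v_def)
  ultimately show ?thesis by simp
qed

lemma bruhat_le_c_op: "bruhat_le n u (c_op n v)"
proof -
  have "v (pos_v + 1) \<noteq> v (pos_v + 2)"
    using B_group_eq_iff[OF v_in_B_group] by simp
  then consider (minus_one) "pos_v = - 1"
    | (descent) "pos_v \<noteq> - 1" "v (pos_v + 2) < v (pos_v + 1)"
    | (ascent) "pos_v \<noteq> - 1" "v (pos_v + 1) < v (pos_v + 2)"
    by linarith
  then show ?thesis
  proof cases
    case minus_one
    then show ?thesis by (rule bruhat_le_c_op_if_minus_one)
  next
    case descent
    then show ?thesis by (rule bruhat_le_c_op_if_descent)
  next
    case ascent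
    then show ?thesis by (rule bruhat_le_c_op_if_ascent)
  qed
qed

end

theorem theorem4p9:
  fixes m :: nat and u v :: "int \<Rightarrow> int"
  assumes "m \<ge> 1"
    and "u \<in> W_set (2 * m + 1)" and "v \<in> W_set (2 * m + 1)"
    and "bruhat_less (2 * m + 1) u v"
    and "inv v (int (2 * m + 1)) < inv u (int (2 * m + 1))"
  shows "bruhat_le (2 * m + 1) u (c_op (2 * m + 1) v)"
proof -
  have "W_set_bruhat_pair (2 * m + 1) u v"
    using assms by unfold_locales (simp_all add: bruhat_less_def)
  then show ?thesis
    by (rule W_set_bruhat_pair.bruhat_le_c_op)
qed

end
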